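(* Let $A\in\mathbb{R}^{m\times n}$ ($m,n\ge 1$) have no zero rows, let $r=\mathrm{rank}(A)$, and let $b\in\mathrm{range}(A)$. Let $A=U\Sigma V^\top$ be a compact singular value decomposition and let $\hat A$, $L$, $M$ be the matrices associated with $A$ as defined in the context. Let the cyclic Kaczmarz method for $Ax=b$ be initialized at an arbitrary $x_0\in\mathbb{R}^n$, producing the full-cycle iterates $(x_k)_{k\ge 0}$, and let $x^*$ be the solution of $Ax=b$ closest to $x_0$ (so $x^*$ depends on $x_0$). Then for every $k\ge 0$, $$\sup_{x_0\neq x^*}\frac{\|x_k-x^*\|}{\|x_0-x^*\|}=\|M^k\|_{\mathrm{op}},\qquad \sup_{x_0\ne x^*}\frac{\|Ax_k-b\|}{\|x_0-x^*\|}=\|\Sigma M^k\|_{\mathrm{op}},$$ where the suprema are over all $x_0\in\mathbb{R}^n$ with $x_0\neq x^*$, and, for every $x_0$, $$\frac{1}{k+1}\sum_{i=0}^k\|L^{-1}\hat A(x_i-x^* )\|^2=\frac{\|x_0-x^*\|^2-\|x_{k+1}-x^*\|^2}{k+1}.$$ As a consequence, for every $x_0$ and all $k\ge 1$, $$\|Ax_k-b\|^2\le\min\Big\{\|\Sigma M\|_{\mathrm{op}}^2\,\|M^{k-1}\|_{\mathrm{op}}^2\,\|x_0-x^*\|^2,\ \frac{(r-1)\max_{1\le i\le m}\|a_i\|^2\,\|L-I_m\|_{\mathrm{op}}^2\,\|x_0-x^*\|^2}{k}\Big\}$$ and $$\frac1k\sum_{i=1}^k\|A(x_i-x^* )\|^2\le\frac{\max_{1\le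 i\le m}\|a_i\|^2\,\|L-I_m\|_{\mathrm{op}}^2\,\|x_0-x^*\|^2}{k}.$$
   Context: $\|\cdot\|$ is the Euclidean norm on vectors and $\|\cdot\|_{\mathrm{op}}$ the induced operator (spectral) norm on matrices; $I_p$ is the $p\times p$ identity. The rows of $A$ are $a_1,\dots,a_m\in\mathbb{R}^n$ (viewed as column vectors in inner products), $\hat a_i=a_i/\|a_i\|$, and $\hat A\in\mathbb{R}^{m\times n}$ is the matrix with rows $\hat a_i$. Compact SVD: $A=U\Sigma V^\top$ with $U\in\mathbb{R}^{m\times r}$, $V\in\mathbb{R}^{n\times r}$, $U^\top U=V^\top V=I_r$, $\Sigma=\mathrm{diag}(\sigma_1,\dots,\sigma_r)$, $\sigma_1\ge\dots\ge\sigma_r>0$. $L\in\mathbb{R}^{m\times m}$ is the unit lower triangular matrix with $L_{ij}=\langle\hat a_i,\hat a_j\rangle$ for $j<i$, $L_{ii}=1$, $L_{ij}=0$ for $j>i$. $M:=I_r-(\hat AV)^\top L^{-1}\hat AV\in\mathbb{R}^{r\times r}$. $M^0=I_r$. Cyclic Kaczmarz method: $x_{0,0}=x_0$; for each $k\ge0$ and $i=1,\dots,m$ in this order, $x_{k,i}=x_{k,i-1}-\frac{\langle a_i,x_{k,i-1}\rangle-b^{(i)}}{\|a_i\|^2}a_i$, where $b^{(i)}$ is the $i$-th entry of $b$; then $x_{k+1}=x_{k+1,0}=x_{k,m}$ (and $x_{k,0}=x_k$). $x^*=\mathrm{argmin}_{x:\,Ax=b}\|x_0-x\|=x_0-A^\dagger(Ax_0-b)$,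 where $A^\dagger$ is the Moore–Penrose pseudoinverse. *)

theory Defs
  imports "HOL-Analysis.Analysis"
begin

text \<open>
  Row indices and singular value indices range over finite linearly ordered types. Such a type is
  order isomorphic to \<open>{1..m}\<close> for its cardinality \<open>m\<close>, and the order is what the cyclic sweep,
  the triangular matrix and the ordering of the singular values refer to.
\<close>

definition op_norm :: "real ^ 'n ^ 'm \<Rightarrow> real" where
  "op_norm B = onorm ((*v) B)"

text \<open>The type class power on vectors of vectors is entrywise, hence a separate matrix power.\<close>

primrec mat_power :: "real ^ 'r ^ 'r \<Rightarrow> nat \<Rightarrow> real ^ 'r ^ 'r" where
  "mat_power B 0 = mat 1"
| "mat_power B (Suc k) = B ** mat_power B k"

definition diag_mat :: "('r \<Rightarrow> real) \<Rightarrow> real ^ 'r ^ 'r" where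
  "diag_mat s = (\<chi> i j. if i = j then s i else 0)"

definition compact_svd ::
  "real ^ 'n ^ 'm \<Rightarrow> real ^ ('r::{finite,linorder}) ^ 'm \<Rightarrow>
     real ^ ('r::{finite,linorder}) ^ ('r::{finite,linorder}) \<Rightarrow>
     real ^ ('r::{finite,linorder}) ^ 'n \<Rightarrow> bool" where
  "compact_svd A U S V \<longleftrightarrow>
     CARD('r) = rank A \<and>
     A = U ** S ** transpose V \<and>
     transpose U ** U = mat 1 \<and>
     transpose V ** V = mat 1 \<and>
     (\<exists>s. S = diag_mat s \<and> antimono s \<and> (\<forall>i. 0 < s i))"

definition normalize_rows :: "real ^ 'n ^ 'm \<Rightarrow> real ^ 'n ^ 'm" where
  "normalize_rows A = (\<chi> i. row i A /\<^sub>R norm (row i A))"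

definition lower_gram :: "real ^ 'n ^ ('m::{finite,linorder}) \<Rightarrow> real ^ ('m::{finite,linorder}) ^ ('m::{finite,linorder})" where
  "lower_gram A = (\<chi> i j.
     if j < i then row i (normalize_rows A) \<bullet> row j (normalize_rows A)
     else if j = i then 1
     else 0)"

definition cycle_mat ::
  "real ^ 'n ^ ('m::{finite,linorder}) \<Rightarrow> real ^ 'r ^ 'n \<Rightarrow> real ^ 'r ^ 'r" where
  "cycle_mat A V =
     mat 1 - transpose (normalize_rows A ** V) ** matrix_inv (lower_gram A) ** (normalize_rows A ** V)"

definition kaczmarz_step ::
  "real ^ 'n ^ 'm \<Rightarrow> real ^ 'm \<Rightarrow> 'm \<Rightarrow> real ^ 'n \<Rightarrow> real ^ 'n" where
  "kaczmarz_step A b i x = x - ((row i A \<bullet> x - b $ i) / (norm (row i A))\<^sup>2) *\<^sub>R row i A"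

definition kaczmarz_cycle ::
  "real ^ 'n ^ ('m::{finite,linorder}) \<Rightarrow> real ^ ('m::{finite,linorder}) \<Rightarrow> real ^ 'n \<Rightarrow> real ^ 'n" where
  "kaczmarz_cycle A b x = fold (kaczmarz_step A b) (sorted_list_of_set UNIV) x"

primrec kaczmarz ::
  "real ^ 'n ^ ('m::{finite,linorder}) \<Rightarrow> real ^ ('m::{finite,linorder}) \<Rightarrow> real ^ 'n \<Rightarrow> nat \<Rightarrow> real ^ 'n" where
  "kaczmarz A b x0 0 = x0"
| "kaczmarz A b x0 (Suc k) = kaczmarz_cycle A b (kaczmarz A b x0 k)"

definition nearest_solution ::
  "real ^ 'n ^ 'm \<Rightarrow> real ^ 'm \<Rightarrow> real ^ 'n \<Rightarrow> real ^ 'n" where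
  "nearest_solution A b x0 = closest_point {x. A *v x = b} x0"

end

theory Submission
  imports Defs
begin

text \<open>A full cycle maps the error \<open>e\<close> to \<open>e - H\<^sup>T c\<close>, where \<open>H\<close> is the row-normalized matrix and
  \<open>L c = H e\<close>. The initial error lies in the range of \<open>V\<close>, and writing \<open>e = V z\<close> the cycle becomes \<open>z \<mapsto> M z\<close>.
  From \<open>L + L\<^sup>T = I + H H\<^sup>T\<close> one obtains \<open>\<parallel>M z\<parallel>\<^sup>2 = \<parallel>z\<parallel>\<^sup>2 - \<parallel>c\<parallel>\<^sup>2\<close>, which
  telescopes, and that the new normalized residual is \<open>(I - L\<^sup>T) c\<close>, which bounds the residuals
  by the decrease of the squared error. For the last iterate the decrease is measured in the
  Frobenius norm, where it is monotone along the powers of a contraction.\<close>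

declare transpose_matrix_vector [simp del]

section \<open>Euclidean, Frobenius and operator norms of matrices\<close>

lemma sq_norm_vec: "(norm x)\<^sup>2 = (\<Sum>i\<in>UNIV. (x $ i)\<^sup>2)"
  for x :: "real ^ 'n"
  by (simp add: norm_vec_def L2_set_def sum_nonneg)

lemma row_inner: "row i B \<bullet> x = (B *v x) $ i"
  for B :: "real ^ 'n ^ 'm"
  by (simp add: matrix_vector_mul_component row_def)

lemma inner_transpose: "y \<bullet> (B *v x) = (transpose B *v y) \<bullet> x"
  for B :: "real ^ 'a ^ 'b"
  by (simp add: dot_lmul_matrix transpose_matrix_vector)

text \<open>\<open>norm\<close> of a matrix is the norm of nested vectors, that is, the Frobenius
  norm; Cauchy-Schwarz in each row gives the bound.\<close>

lemma norm_matrix_vector_mult_le_norm: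
  fixes B :: "real ^ 'n ^ 'm"
  shows "norm (B *v x) \<le> norm B * norm x"
proof -
  have "(norm (B *v x))\<^sup>2 = (\<Sum>i\<in>UNIV. (row i B \<bullet> x)\<^sup>2)"
    by (simp add: sq_norm_vec row_inner)
  also have "\<dots> \<le> (\<Sum>i\<in>UNIV. (norm (row i B))\<^sup>2 * (norm x)\<^sup>2)"
    by (intro sum_mono) (metis Cauchy_Schwarz_ineq power2_norm_eq_inner)
  also have "\<dots> = (norm B * norm x)\<^sup>2"
    by (simp add: norm_vec_def[of B] L2_set_def row_def sum_nonneg power_mult_distrib sum_distrib_right)
  finally show ?thesis
    by (rule power2_le_imp_le) simp
qed

text \<open>Testing the bound on \<open>B\<close> at the vector \<open>transpose B *v y\<close>
  leaves one factor \<open>norm (transpose B *v y)\<close> to cancel.\<close>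

lemma norm_transpose_mult_le:
  fixes B :: "real ^ 'n ^ 'm"
  assumes "\<And>x. norm (B *v x) \<le> K * norm x"
  shows "norm (transpose B *v y) \<le> K * norm y"
proof (cases "transpose B *v y = 0")
  case True
  have "0 \<le> K * norm (1 :: real ^ 'n)"
    using assms norm_ge_zero order_trans by blast
  then have "K \<ge> 0"
    by (simp add: zero_le_mult_iff)
  with True show ?thesis by simp
next
  case False
  have "norm (transpose B *v y) * norm (transpose B *v y) = y \<bullet> (B *v (transpose B *v y))"
    by (metis dot_lmul_matrix norm_eq_square power2_eq_square power2_norm_eq_inner transpose_matrix_vector)
  also have "\<dots> \<le> norm y * norm (B *v (transpose B *v y))"
    by (rule norm_cauchy_schwarz)
  also have "\<dots> \<le> norm y * (K * norm (transpose B *v y))"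
    by (intro mult_left_mono assms) simp
  finally show ?thesis
    using False by (simp add: mult.assoc[symmetric] mult.commute)
qed

text \<open>The rows of \<open>X ** Y\<close> are the images of the rows of \<open>X\<close> under
  \<open>transpose Y\<close>, which is a contraction along with \<open>Y\<close>.\<close>

lemma norm_matrix_mult_contraction:
  fixes X :: "real ^ 'n ^ 'm" and Y :: "real ^ 'p ^ 'n"
  assumes "\<And>x. norm (Y *v x) \<le> norm x"
  shows "norm (X ** Y) \<le> norm X"
proof -
  have "(X ** Y) $ i = transpose Y *v (X $ i)" for i
    by (simp add: matrix_matrix_mult_def matrix_vector_mult_def transpose_def vec_eq_iff mult.commute)
  moreover have "norm (transpose Y *v (X $ i)) \<le> norm (X $ i)" for i
    using norm_transpose_mult_le[of Y 1] assms by simp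
  ultimately show ?thesis
    unfolding norm_vec_def by (intro L2_set_mono) auto
qed

text \<open>Lets an estimate valid for every vector be summed over columns into a Frobenius
  estimate.\<close>

lemma norm_matrix_eq_sum_columns:
  fixes B :: "real ^ 'n ^ 'm"
  shows "(norm B)\<^sup>2 = (\<Sum>j\<in>UNIV. (norm (B *v axis j 1))\<^sup>2)"
proof -
  have "(norm B)\<^sup>2 = (\<Sum>i\<in>UNIV. \<Sum>j\<in>UNIV. (B $ i $ j)\<^sup>2)"
    by (simp add: norm_vec_def[of B] L2_set_def sum_nonneg sq_norm_vec)
  also have "\<dots> = (\<Sum>j\<in>UNIV. \<Sum>i\<in>UNIV. (B $ i $ j)\<^sup>2)"
    by (rule sum.swap)
  also have "\<dots> = (\<Sum>j\<in>UNIV. (norm (B *v axis j 1))\<^sup>2)"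
    by (simp add: sq_norm_vec matrix_vector_mult_basis column_def)
  finally show ?thesis .
qed

lemma norm_orthonormal_columns:
  fixes B :: "real ^ 'n ^ 'm"
  assumes "transpose B ** B = mat 1"
  shows "norm (B *v x) = norm x"
proof -
  have "(B *v x) \<bullet> (B *v x) = x \<bullet> (transpose B *v (B *v x))"
    by (metis dot_lmul_matrix inner_commute transpose_matrix_vector)
  then show ?thesis
    by (simp add: matrix_vector_mul_assoc assms norm_eq_sqrt_inner)
qed

lemma norm_le_op_norm: "norm (B *v x) \<le> op_norm B * norm x"
  unfolding op_norm_def by (intro onorm matrix_vector_mul_bounded_linear)

lemma op_norm_nonneg: "0 \<le> op_norm B"
  unfolding op_norm_def by (intro onorm_pos_le matrix_vector_mul_bounded_linear)

lemma SUP_norm_ratio_eq_op_norm: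
  fixes B :: "real ^ 'n ^ 'm"
  shows "(SUP z \<in> {z. z \<noteq> 0}. ereal (norm (B *v z) / norm z)) = ereal (op_norm B)"
proof (rule antisym)
  show "(SUP z \<in> {z. z \<noteq> 0}. ereal (norm (B *v z) / norm z)) \<le> ereal (op_norm B)"
    using norm_le_op_norm[of B] by (intro SUP_least) (auto simp: divide_le_eq)
next
  define s where "s = (SUP z \<in> {z. z \<noteq> 0}. ereal (norm (B *v z) / norm z))"
  have up: "ereal (norm (B *v z) / norm z) \<le> s" if "z \<noteq> 0" for z
    unfolding s_def using that by (intro SUP_upper) auto
  \<comment> \<open>The all-ones vector shows that the supremum runs over a nonempty set, which
    excludes the value minus infinity.\<close>
  have "0 \<le> ereal (norm (B *v 1) / norm (1 :: real ^ 'n))"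
    by simp
  also have "\<dots> \<le> s"
    by (rule up) (simp add: vec_eq_iff)
  finally have "0 \<le> s" .
  then show "ereal (op_norm B) \<le> s"
  proof (cases s)
    case (real u)
    have "norm (B *v z) \<le> u * norm z" for z
      using up[of z] real by (cases "z = 0") (auto simp: divide_le_eq)
    then have "onorm ((*v) B) \<le> u"
      by (intro onorm_le)
    then show ?thesis
      using real by (simp add: op_norm_def)
  qed auto
qed

section \<open>The last iterate of a contraction, and projection onto a hyperplane\<close>

text \<open>The Frobenius norms of \<open>E N\<^sup>i P\<close> decrease in \<open>i\<close> because \<open>N\<close> is a contraction acting on
  the right, and their squares telescope; hence the last of them is at most their average.\<close>

lemma contraction_last_iterate:
  fixes P N :: "real ^ 'r ^ 'r" and E :: "real ^ 'r ^ 'm"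
  assumes PP: "P ** P = P" and PN: "P ** N = N" and NP: "N ** P = N"
    and P_le: "\<And>x. norm (P *v x) \<le> norm x"
    and E_le: "\<And>x. (norm (E *v x))\<^sup>2 \<le> (norm (P *v x))\<^sup>2 - (norm (N *v x))\<^sup>2"
  shows "real (Suc k) * (norm (E *v (mat_power N k *v (P *v z))))\<^sup>2 \<le> (norm P)\<^sup>2 * (norm z)\<^sup>2"
proof -
  define T where "T i = mat_power N i ** P" for i
  have T_Suc: "T (Suc i) = N ** T i" for i
    by (simp add: T_def matrix_mul_assoc)
  have PT: "P ** T i = T i" for i
    by (cases i) (simp_all add: T_def PP PN matrix_mul_assoc)
  \<comment> \<open>Telescoping needs the new factor \<open>N\<close> on the left, monotonicity
    needs it on the right; both forms agree because \<open>P\<close> is absorbed by \<open>N\<close>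
    on either side.\<close>
  have T_Suc': "T (Suc i) = T i ** N" for i
  proof (induction i)
    case 0
    show ?case by (simp add: T_Suc) (simp add: T_def NP PN)
  next
    case (Suc i)
    then show ?case by (metis T_Suc matrix_mul_assoc)
  qed
  have N_le: "norm (N *v x) \<le> norm x" for x
  proof -
    have "(norm (N *v x))\<^sup>2 \<le> (norm (P *v x))\<^sup>2"
      using E_le[of x] zero_le_power2[of "norm (E *v x)"] by linarith
    then show ?thesis
      using P_le[of x] power2_le_imp_le[OF _ norm_ge_zero] by (meson order_trans)
  qed
  define F where "F i = (norm (E ** T i))\<^sup>2" for i
  have "F (Suc i) \<le> F i" for i
    unfolding F_def T_Suc' matrix_mul_assoc
    by (intro power_mono norm_matrix_mult_contraction N_le) simp
  then have decF: "F k \<le> F i" if "i \<le> k" for i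
    using lift_Suc_antimono_le[of F] that by blast
  have F_le: "F i \<le> (norm (T i))\<^sup>2 - (norm (T (Suc i)))\<^sup>2" for i
  proof -
    \<comment> \<open>\<open>E_le\<close> is applied to every column of \<open>T i\<close>; the
      factor \<open>P\<close> then disappears by \<open>PT\<close>.\<close>
    have "F i \<le> (\<Sum>j\<in>UNIV. (norm (P *v (T i *v axis j 1)))\<^sup>2 - (norm (N *v (T i *v axis j 1)))\<^sup>2)"
      unfolding F_def norm_matrix_eq_sum_columns matrix_vector_mul_assoc[symmetric]
      by (intro sum_mono E_le)
    also have "\<dots> = (norm (T i))\<^sup>2 - (norm (T (Suc i)))\<^sup>2"
      by (simp add: norm_matrix_eq_sum_columns matrix_vector_mul_assoc PT T_Suc sum_subtractf)
    finally show ?thesis .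
  qed
  have "real (Suc k) * F k = (\<Sum>i\<in>{..k}. F k)"
    by simp
  also have "\<dots> \<le> (\<Sum>i\<le>k. F i)"
    by (intro sum_mono decF) simp
  also have "\<dots> \<le> (\<Sum>i\<le>k. (norm (T i))\<^sup>2 - (norm (T (Suc i)))\<^sup>2)"
    by (intro sum_mono F_le)
  also have "\<dots> = (norm (T 0))\<^sup>2 - (norm (T (Suc k)))\<^sup>2"
    by (rule sum_telescope)
  \<comment> \<open>\<open>T 0\<close> is \<open>P\<close>, so the whole budget for the sum is the
    squared Frobenius norm of \<open>P\<close>; the dimension factor enters here.\<close>
  also have "\<dots> \<le> (norm P)\<^sup>2"
    by (simp add: T_def)
  finally have *: "real (Suc k) * F k \<le> (norm P)\<^sup>2" .
  have "(norm (E *v (mat_power N k *v (P *v z))))\<^sup>2 \<le> F k * (norm z)\<^sup>2"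
    unfolding F_def T_def power_mult_distrib[symmetric] matrix_vector_mul_assoc matrix_mul_assoc
    by (intro power_mono norm_matrix_vector_mult_le_norm) simp
  then have "real (Suc k) * (norm (E *v (mat_power N k *v (P *v z))))\<^sup>2 \<le> real (Suc k) * (F k * (norm z)\<^sup>2)"
    by (rule mult_left_mono) simp
  also have "\<dots> = (real (Suc k) * F k) * (norm z)\<^sup>2"
    by simp
  also have "\<dots> \<le> (norm P)\<^sup>2 * (norm z)\<^sup>2"
    by (intro mult_right_mono *) simp
  finally show ?thesis .
qed

text \<open>The matrix I - w w^T; for a unit vector \<open>w\<close> it is the orthogonal projection
  onto the complement of \<open>w\<close>.\<close>

definition proj_compl :: "real ^ 'r \<Rightarrow> real ^ 'r ^ 'r" where
  "proj_compl w = (\<chi> i j. (if i = j then 1 else 0) - w $ i * w $ j)"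

lemma proj_compl_mult: "proj_compl w *v x = x - (w \<bullet> x) *\<^sub>R w"
proof -
  have "(proj_compl w *v x) $ i = x $ i - (w \<bullet> x) * w $ i" for i
  proof -
    have "(proj_compl w *v x) $ i = (\<Sum>j\<in>UNIV. (if i = j then x $ j else 0) - w $ i * (w $ j * x $ j))"
      unfolding proj_compl_def matrix_vector_mult_def
      by (auto intro!: sum.cong simp: algebra_simps)
    then show ?thesis
      by (simp add: sum_subtractf inner_vec_def sum_distrib_left[symmetric] mult.commute)
  qed
  then show ?thesis
    by (simp add: vec_eq_iff)
qed

lemma norm_proj_compl_mult:
  assumes "norm w = 1"
  shows "(norm (proj_compl w *v x))\<^sup>2 = (norm x)\<^sup>2 - (w \<bullet> x)\<^sup>2"
  using assms unfolding proj_compl_mult norm_eq_1 power2_norm_eq_inner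
  by (simp add: algebra_simps inner_commute power2_eq_square)

text \<open>Column \<open>j\<close> has squared norm \<open>1 - (w $ j)\<^sup>2\<close>, and the
  subtracted terms add up to 1.\<close>

lemma norm_proj_compl:
  fixes w :: "real ^ 'r"
  assumes "norm w = 1"
  shows "(norm (proj_compl w))\<^sup>2 = real CARD('r) - 1"
proof -
  have "(\<Sum>j\<in>UNIV. (w $ j)\<^sup>2) = 1"
    using assms by (simp add: norm_eq_1 inner_vec_def power2_eq_square)
  then show ?thesis
    by (simp add: norm_matrix_eq_sum_columns norm_proj_compl_mult[OF assms] sum_subtractf inner_axis)
qed

section \<open>Kernel and range of \<open>A\<close> and \<open>Ah\<close> in terms of
  \<open>V\<close>\<close>

locale kaczmarz_svd =
  fixes A :: "real ^ 'n ^ ('m::{finite,linorder})"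
    and b :: "real ^ ('m::{finite,linorder})"
    and U :: "real ^ ('r::{finite,linorder}) ^ ('m::{finite,linorder})"
    and S :: "real ^ ('r::{finite,linorder}) ^ ('r::{finite,linorder})"
    and V :: "real ^ ('r::{finite,linorder}) ^ 'n"
  assumes row_nz: "row i A \<noteq> 0"
    and b_range: "b \<in> range ((*v) A)"
    and svd: "compact_svd A U S V"
begin

abbreviation "Ah \<equiv> normalize_rows A"
abbreviation "L \<equiv> lower_gram A"
abbreviation "M \<equiv> cycle_mat A V"
abbreviation "sweep e \<equiv> matrix_inv L *v (Ah *v e)"

lemma A_eq: "A = U ** S ** transpose V"
  and UU: "transpose U ** U = mat 1"
  and VV: "transpose V ** V = mat 1"
  and card_r: "CARD('r) = rank A"
  using svd by (auto simp: compact_svd_def)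

lemma S_inj: "S *v x = 0 \<Longrightarrow> x = 0"
proof -
  obtain s where s: "S = diag_mat s" "\<forall>i. 0 < s i"
    using svd by (auto simp: compact_svd_def)
  have "(S *v x) $ i = s i * x $ i" for i
    by (simp add: s(1) diag_mat_def matrix_vector_mult_def if_distrib[where f = "\<lambda>a. a * _"] cong: if_cong)
  then show "S *v x = 0 \<Longrightarrow> x = 0"
    using s(2) by (metis less_irrefl mult_eq_0_iff vec_eq_iff zero_index)
qed

lemma VtV: "transpose V *v (V *v z) = z"
  by (simp add: matrix_vector_mul_assoc VV)

lemma norm_V: "norm (V *v z) = norm z"
  by (rule norm_orthonormal_columns[OF VV])

lemma A_mult: "A *v x = U *v (S *v (transpose V *v x))"
  by (simp add: A_eq matrix_vector_mul_assoc matrix_mul_assoc)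

lemma norm_A_V: "norm (A *v (V *v z)) = norm (S *v z)"
  by (simp add: A_mult VtV norm_orthonormal_columns[OF UU])

text \<open>\<open>U\<close> preserves norms and \<open>S\<close> is injective, so the kernel of
  \<open>A\<close> is that of \<open>transpose V\<close>.\<close>

lemma A_null: "A *v x = 0 \<Longrightarrow> transpose V *v x = 0"
  unfolding A_mult by (metis S_inj norm_eq_zero norm_orthonormal_columns[OF UU])

lemma row_Ah: "row i Ah = row i A /\<^sub>R norm (row i A)"
  by (simp add: normalize_rows_def row_def vec_eq_iff)

lemma norm_row_Ah: "norm (row i Ah) = 1"
  using row_nz by (simp add: row_Ah)

lemma A_mult_Ah: "(A *v x) $ i = norm (row i A) * (Ah *v x) $ i"
  using row_nz[of i] by (simp add: row_inner[symmetric] row_Ah)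

lemma Ah_null:
  assumes "transpose V *v x = 0"
  shows "Ah *v x = 0"
proof -
  have "A *v x = 0"
    by (simp add: A_mult assms)
  then have "norm (row i A) * (Ah *v x) $ i = 0" for i
    using A_mult_Ah[of x i] by simp
  then show ?thesis
    using row_nz by (simp add: vec_eq_iff[of "Ah *v x"])
qed

text \<open>\<open>x\<close> and its projection onto the range of \<open>V\<close> differ by a
  vector that \<open>transpose V\<close>, and hence \<open>Ah\<close>, annihilates.\<close>

lemma Ah_VVt: "Ah *v (V *v (transpose V *v x)) = Ah *v x"
  using Ah_null[of "V *v (transpose V *v x) - x"] by (simp add: matrix_vector_mult_diff_distrib VtV)

text \<open>The transpose of \<open>Ah_VVt\<close>: corrections made by a cycle stay in the range of
  \<open>V\<close>.\<close>

lemma VVt_Ah: "V *v (transpose V *v (transpose Ah *v y)) = transpose Ah *v y"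
proof -
  have "Ah ** (V ** transpose V) = Ah"
    by (simp add: matrix_eq matrix_vector_mul_assoc[symmetric] Ah_VVt)
  then have "(V ** transpose V) ** transpose Ah = transpose Ah"
    by (metis matrix_transpose_mul transpose_transpose)
  then show ?thesis
    by (simp add: matrix_vector_mul_assoc matrix_mul_assoc)
qed

section \<open>The triangular matrix \<open>L\<close>: symmetric part, inverse and
  substitution\<close>

lemma L_nth: "L $ i $ j = (if j < i then row i Ah \<bullet> row j Ah else if j = i then 1 else 0)"
  by (simp add: lower_gram_def)

text \<open>Each off-diagonal Gram entry occurs in exactly one of the two triangles; on the diagonal
  2 = 1 + 1 because the rows are normalized.\<close>

lemma L_plus_transpose: "L + transpose L = mat 1 + Ah ** transpose Ah"
proof -
  have "(Ah ** transpose Ah) $ i $ j = row i Ah \<bullet> row j Ah" for i j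
    by (simp add: matrix_matrix_mult_def transpose_def row_def inner_vec_def)
  moreover have "row i Ah \<bullet> row i Ah = 1" for i
    using norm_row_Ah[of i] by (simp add: norm_eq_1)
  ultimately show ?thesis
    by (auto simp: vec_eq_iff L_nth transpose_def mat_def inner_commute)
qed

lemma L_plus_transpose_mult: "L *v c + transpose L *v c = c + Ah *v (transpose Ah *v c)"
  using arg_cong[OF L_plus_transpose, of "\<lambda>X. X *v c"]
  by (simp add: matrix_vector_mult_add_rdistrib matrix_vector_mul_assoc)

text \<open>A quadratic form sees only the symmetric part of its matrix. In particular
  \<open>L\<close> is positive definite.\<close>

lemma two_inner_L: "2 * (c \<bullet> (L *v c)) = (norm c)\<^sup>2 + (norm (transpose Ah *v c))\<^sup>2"
proof -
  have "2 * (c \<bullet> (L *v c)) = c \<bullet> (L *v c + transpose L *v c)"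
    by (simp add: inner_add_right inner_transpose[of c L] inner_commute)
  then show ?thesis
    by (simp add: L_plus_transpose_mult inner_add_right inner_transpose power2_norm_eq_inner)
qed

text \<open>Positive definiteness makes the kernel of \<open>L\<close> trivial. As
  \<open>matrix_inv\<close> is a choice, a two-sided inverse has to be exhibited.\<close>

lemma L_inv: "L ** matrix_inv L = mat 1" "matrix_inv L ** L = mat 1"
proof -
  have "c = 0" if "L *v c = 0" for c
    using two_inner_L[of c] that by (simp add: add_nonneg_eq_0_iff)
  then have "\<exists>B. B ** L = mat 1"
    using matrix_left_invertible_ker by blast
  then have "\<exists>B. L ** B = mat 1 \<and> B ** L = mat 1"
    using matrix_left_right_inverse by blast
  then have "L ** matrix_inv L = mat 1 \<and> matrix_inv L ** L = mat 1"
    unfolding matrix_inv_def by (rule someI_ex)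
  then show "L ** matrix_inv L = mat 1" "matrix_inv L ** L = mat 1"
    by auto
qed

lemma L_sweep: "L *v sweep e = Ah *v e"
  by (simp add: matrix_vector_mul_assoc matrix_mul_assoc L_inv)

text \<open>The unit diagonal allows row \<open>i\<close> of the system \<open>L c = Ah e\<close> to
  be solved for \<open>c $ i\<close> from the earlier entries.\<close>

lemma sweep_rec: "sweep e $ i = (Ah *v e) $ i - (\<Sum>j | j < i. (row i Ah \<bullet> row j Ah) * sweep e $ j)"
proof -
  have "(L *v c) $ i = c $ i + (\<Sum>j | j < i. (row i Ah \<bullet> row j Ah) * c $ j)" for c
  proof -
    have "(L *v c) $ i = (\<Sum>j\<in>UNIV. (if j = i then c $ j else 0)
        + (if j < i then (row i Ah \<bullet> row j Ah) * c $ j else 0))"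
      unfolding matrix_vector_mult_def by (auto intro!: sum.cong simp: L_nth)
    then show ?thesis
      by (simp add: sum.distrib sum.If_cases)
  qed
  from this[of "sweep e"] show ?thesis
    by (simp only: L_sweep)
qed

section \<open>The effect of one cycle on the error\<close>

lemma transpose_Ah_mult: "transpose Ah *v c = (\<Sum>j\<in>UNIV. c $ j *\<^sub>R row j Ah)"
  by (simp add: vec_eq_iff matrix_vector_mult_def transpose_def row_def mult.commute)

text \<open>The step at row \<open>i\<close> subtracts \<open>c\<^sub>i\<close> times the normalized row, where \<open>L c\<close> is the
  normalized residual at the start of the cycle: forward substitution.\<close>

lemma kaczmarz_cycle_eq:
  assumes "A *v p = b"
  shows "kaczmarz_cycle A b (p + e) = p + (e - transpose Ah *v sweep e)"
proof -
  define xs where "xs = sorted_list_of_set (UNIV :: 'm set)"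
  have xs: "sorted_wrt (<) xs" "set xs = UNIV"
    by (simp_all add: xs_def)
  \<comment> \<open>Induction over prefixes of the row list. Keeping the suffix \<open>zs\<close>
    lets the sortedness of the full list show that the rows processed before \<open>i\<close> are
    exactly those below \<open>i\<close>.\<close>
  have "fold (kaczmarz_step A b) ys (p + e) = p + (e - (\<Sum>j\<in>set ys. sweep e $ j *\<^sub>R row j Ah))"
    if "xs = ys @ zs" for ys zs
    using that
  proof (induction ys arbitrary: zs rule: rev_induct)
    case (snoc i ys)
    define c where "c = sweep e"
    have xs_eq: "xs = ys @ i # zs"
      using snoc.prems by simp
    have ys: "set ys = {j. j < i}"
      using xs unfolding xs_eq
      by (auto simp: sorted_wrt_append) (metis Un_iff UNIV_I insert_iff not_less_iff_gr_or_eq)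
    define f where "f = e - (\<Sum>j | j < i. c $ j *\<^sub>R row j Ah)"
    have IH: "fold (kaczmarz_step A b) ys (p + e) = p + f"
      using snoc.IH[OF xs_eq] by (simp add: ys f_def c_def)
    have b_i: "row i A \<bullet> p = b $ i"
      using assms by (auto simp: matrix_vector_mul_component row_def)
    \<comment> \<open>The earlier corrections remove from the residual of row \<open>i\<close>
      precisely the sum in \<open>sweep_rec\<close>.\<close>
    have "row i Ah \<bullet> f = c $ i"
      unfolding f_def c_def sweep_rec[of e i]
      by (simp add: inner_diff_right inner_sum_right matrix_vector_mul_component row_def mult.commute)
    then have "row i A \<bullet> f = norm (row i A) * c $ i"
      using row_nz[of i] by (simp add: row_Ah field_simps)
    then have "kaczmarz_step A b i (p + f) = p + (f - c $ i *\<^sub>R row i Ah)"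
      using row_nz[of i]
      by (simp add: kaczmarz_step_def inner_add_right b_i row_Ah power2_eq_square divide_inverse)
    moreover have "(\<Sum>j\<in>set (ys @ [i]). c $ j *\<^sub>R row j Ah) = (\<Sum>j | j < i. c $ j *\<^sub>R row j Ah) + c $ i *\<^sub>R row i Ah"
      by (simp add: ys)
    ultimately show ?case
      by (simp add: IH f_def c_def diff_diff_eq)
  qed simp
  from this[of xs "[]"] show ?thesis
    by (simp add: kaczmarz_cycle_def xs_def transpose_Ah_mult)
qed

section \<open>The cycle in the coordinates \<open>z\<close>, and the energy identity\<close>

lemma M_mult: "M *v z = z - transpose V *v (transpose Ah *v sweep (V *v z))"
  by (simp add: cycle_mat_def matrix_vector_mult_diff_rdistrib matrix_transpose_mul
      matrix_vector_mul_assoc matrix_mul_assoc)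

text \<open>The correction lies in the range of \<open>V\<close> by \<open>VVt_Ah\<close>, so
  passing to coordinates and back loses nothing.\<close>

lemma V_M_mult: "V *v (M *v z) = V *v z - transpose Ah *v sweep (V *v z)"
  by (simp add: M_mult matrix_vector_mult_diff_distrib VVt_Ah)

text \<open>Expanding the square gives a cross term \<open>2 * (c \<bullet> (L *v c))\<close>; by
  \<open>two_inner_L\<close> it cancels the square of the correction and leaves the squared norm of
  \<open>c\<close>.\<close>

lemma norm_M_mult: "(norm (M *v z))\<^sup>2 = (norm z)\<^sup>2 - (norm (sweep (V *v z)))\<^sup>2"
proof -
  define c where "c = sweep (V *v z)"
  have "(norm (M *v z))\<^sup>2 = (norm (V *v z - transpose Ah *v c))\<^sup>2"
    unfolding c_def by (metis V_M_mult norm_V)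
  also have "\<dots> = (norm (V *v z))\<^sup>2 - 2 * ((transpose Ah *v c) \<bullet> (V *v z)) + (norm (transpose Ah *v c))\<^sup>2"
    by (simp add: power2_norm_eq_inner algebra_simps inner_commute)
  also have "(transpose Ah *v c) \<bullet> (V *v z) = c \<bullet> (L *v c)"
    by (simp add: inner_transpose[symmetric] c_def L_sweep)
  finally show ?thesis
    using two_inner_L[of c] by (simp add: norm_V c_def)
qed

lemma norm_M_le: "norm (M *v z) \<le> norm z"
  by (rule power2_le_imp_le) (simp_all add: norm_M_mult)

section \<open>Residuals bounded by the decrease of the squared error\<close>

abbreviation "C \<equiv> (MAX i. (norm (row i A))\<^sup>2) * (op_norm (L - mat 1))\<^sup>2"

lemma row_le_Max: "(norm (row i A))\<^sup>2 \<le> (MAX i. (norm (row i A))\<^sup>2)"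
  by (intro Max_ge) auto

lemma C_nonneg: "0 \<le> C"
  using order_trans[OF zero_le_power2 row_le_Max] by (intro mult_nonneg_nonneg) auto

text \<open>The identity for \<open>L + transpose L\<close> turns the new normalized residual into
  \<open>- (transpose (L - mat 1) *v c)\<close>; undoing the normalization costs at most the largest
  squared row norm.\<close>

lemma norm_residual_le: "(norm (A *v (V *v (M *v z))))\<^sup>2 \<le> C * (norm (sweep (V *v z)))\<^sup>2"
proof -
  define c where "c = sweep (V *v z)"
  define f where "f = V *v (M *v z)"
  have "Ah *v f = L *v c - Ah *v (transpose Ah *v c)"
    by (simp add: f_def V_M_mult c_def matrix_vector_mult_diff_distrib L_sweep)
  also have "\<dots> = - (transpose (L - mat 1) *v c)"
    using L_plus_transpose_mult[of c]
    by (simp add: transpose_matrix_vector vector_matrix_mult_diff_rdistrib algebra_simps)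
  finally have "norm (Ah *v f) \<le> op_norm (L - mat 1) * norm c"
    using norm_transpose_mult_le[OF norm_le_op_norm, of "L - mat 1" c] by simp
  then have *: "(norm (Ah *v f))\<^sup>2 \<le> (op_norm (L - mat 1))\<^sup>2 * (norm c)\<^sup>2"
    by (metis norm_ge_zero power_mono power_mult_distrib)
  have "(norm (A *v f))\<^sup>2 = (\<Sum>i\<in>UNIV. (norm (row i A))\<^sup>2 * ((Ah *v f) $ i)\<^sup>2)"
    by (simp add: sq_norm_vec[of "A *v f"] A_mult_Ah power_mult_distrib)
  also have "\<dots> \<le> (\<Sum>i\<in>UNIV. (MAX i. (norm (row i A))\<^sup>2) * ((Ah *v f) $ i)\<^sup>2)"
    by (intro sum_mono mult_right_mono row_le_Max) simp
  also have "\<dots> = (MAX i. (norm (row i A))\<^sup>2) * (norm (Ah *v f))\<^sup>2"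
    by (simp add: sq_norm_vec[of "Ah *v f"] sum_distrib_left)
  also have "\<dots> \<le> (MAX i. (norm (row i A))\<^sup>2) * ((op_norm (L - mat 1))\<^sup>2 * (norm c)\<^sup>2)"
    using order_trans[OF zero_le_power2 row_le_Max] by (intro mult_left_mono *) auto
  finally show ?thesis
    by (simp add: f_def c_def mult.assoc)
qed

section \<open>The nearest solution and the coordinates of the initial error\<close>

lemma nearest_solution_eq:
  assumes "A *v p = b"
  shows "nearest_solution A b (p + V *v z) = p"
proof -
  let ?X = "{x. A *v x = b}"
  \<comment> \<open>Writing the solution set as a translated subspace provides the convexity and
    closedness that uniqueness of the closest point requires.\<close>
  have X: "?X = (\<lambda>y. p + y) ` {y. A *v y = 0}"
  proof (intro equalityI subsetI)
    fix x assume "x \<in> ?X"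
    then have "x = p + (x - p)" "A *v (x - p) = 0"
      using assms by (simp_all add: matrix_vector_mult_diff_distrib)
    then show "x \<in> (\<lambda>y. p + y) ` {y. A *v y = 0}"
      by blast
  qed (use assms in \<open>auto simp: matrix_vector_right_distrib\<close>)
  have sub: "subspace {y. A *v y = 0}"
    by (auto simp: subspace_def matrix_vector_right_distrib matrix_vector_mult_scaleR)
  have "convex ?X" "closed ?X"
    unfolding X by (simp_all add: convex_translation closed_translation subspace_imp_convex closed_subspace sub)
  moreover have "\<forall>q\<in>?X. dist (p + V *v z) p \<le> dist (p + V *v z) q"
  proof
    \<comment> \<open>Two solutions differ by a kernel vector of \<open>A\<close>, which is
      orthogonal to the range of \<open>V\<close>; Pythagoras then compares the distances.\<close>
    fix q assume "q \<in> ?X"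
    then have "transpose V *v (p - q) = 0"
      using assms by (intro A_null) (simp add: matrix_vector_mult_diff_distrib)
    then have "(p - q) \<bullet> (V *v z) = 0"
      by (simp add: inner_transpose)
    then have "(norm (p + V *v z - q))\<^sup>2 = (norm (V *v z))\<^sup>2 + (norm (p - q))\<^sup>2"
      unfolding power2_norm_eq_inner by (simp add: algebra_simps inner_commute)
    then have "(norm (V *v z))\<^sup>2 \<le> (norm (p + V *v z - q))\<^sup>2"
      by simp
    then have "norm (V *v z) \<le> norm (p + V *v z - q)"
      by (rule power2_le_imp_le) simp
    then show "dist (p + V *v z) p \<le> dist (p + V *v z) q"
      by (simp add: dist_norm)
  qed
  ultimately show ?thesis
    unfolding nearest_solution_def using assms by (intro closest_point_unique[symmetric]) auto
qed

lemma decompose: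
  obtains p z where "A *v p = b" "x0 = p + V *v z" "nearest_solution A b x0 = p"
proof -
  obtain y where y: "b = A *v y"
    using b_range by auto
  \<comment> \<open>\<open>V *v z\<close> is the projection of \<open>x0 - y\<close> onto the range
    of \<open>V\<close>. The remainder lies in the kernel of \<open>A\<close>, so \<open>p\<close>
    solves the system just as \<open>y\<close> does.\<close>
  define z where "z = transpose V *v (x0 - y)"
  define p where "p = x0 - V *v z"
  have "A *v p = b"
    by (simp add: p_def y matrix_vector_mult_diff_distrib A_mult VtV z_def)
  moreover have "x0 = p + V *v z"
    by (simp add: p_def)
  ultimately show thesis
    using nearest_solution_eq that by blast
qed

section \<open>The iterates in coordinates and the exact suprema\<close>

lemma kaczmarz_eq:
  assumes "A *v p = b"
  shows "kaczmarz A b (p + V *v z) k = p + V *v (mat_power M k *v z)"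
proof (induction k)
  case (Suc k)
  then show ?case
    using V_M_mult[of "mat_power M k *v z"]
    by (simp add: kaczmarz_cycle_eq[OF assms] matrix_vector_mul_assoc[of M])
qed simp

text \<open>Starting points off their nearest solution correspond to nonzero \<open>z\<close>, and
  \<open>V\<close> preserves norms, so both suprema range over the same set of ratios. The function
  \<open>g\<close> covers the error and the residual alike.\<close>

lemma SUP_error_ratio:
  fixes B :: "real ^ ('r::{finite,linorder}) ^ 'p"
  assumes g: "\<And>p z. A *v p = b \<Longrightarrow> g (p + V *v z) = norm (B *v z)"
  shows "(SUP x0 \<in> {x0. x0 \<noteq> nearest_solution A b x0}. ereal (g x0 / norm (x0 - nearest_solution A b x0)))
    = ereal (op_norm B)"
proof -
  have "(\<lambda>x0. ereal (g x0 / norm (x0 - nearest_solution A b x0))) ` {x0. x0 \<noteq> nearest_solution A b x0}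
    = (\<lambda>z. ereal (norm (B *v z) / norm z)) ` {z. z \<noteq> 0}" (is "?l = ?r")
  proof (intro equalityI subsetI)
    fix t assume "t \<in> ?l"
    then obtain x0 where x0: "x0 \<noteq> nearest_solution A b x0"
        "t = ereal (g x0 / norm (x0 - nearest_solution A b x0))"
      by blast
    obtain p z where pz: "A *v p = b" "x0 = p + V *v z" "nearest_solution A b x0 = p"
      by (rule decompose)
    have "z \<noteq> 0"
      using x0(1) pz by auto
    moreover have "t = ereal (norm (B *v z) / norm z)"
      using x0(2) g[OF pz(1), of z] pz by (simp add: norm_V)
    ultimately show "t \<in> ?r"
      by blast
  next
    fix t assume "t \<in> ?r"
    then obtain z where z: "z \<noteq> 0" "t = ereal (norm (B *v z) / norm z)"
      by blast
    \<comment> \<open>A single solution \<open>p\<close> suffices: moving it by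
      \<open>V *v z\<close> realizes every nonzero \<open>z\<close>.\<close>
    obtain p where p: "A *v p = b"
      using b_range by auto
    let ?x = "p + V *v z"
    have near: "nearest_solution A b ?x = p"
      by (rule nearest_solution_eq[OF p])
    have "V *v z \<noteq> 0"
      using z(1) norm_V[of z] by auto
    then have "?x \<noteq> nearest_solution A b ?x"
      by (simp add: near)
    moreover have "t = ereal (g ?x / norm (?x - nearest_solution A b ?x))"
      using z(2) by (simp add: near g[OF p] norm_V)
    ultimately show "t \<in> ?l"
      by blast
  qed
  then show ?thesis
    by (simp only: SUP_norm_ratio_eq_op_norm)
qed

section \<open>Averaged bounds and the bound for the last iterate\<close>

lemma sum_norm_sweep:
  "(\<Sum>i<k. (norm (sweep (V *v (mat_power M i *v z))))\<^sup>2) = (norm z)\<^sup>2 - (norm (mat_power M k *v z))\<^sup>2"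
proof (induction k)
  case (Suc k)
  then show ?case
    using norm_M_mult[of "mat_power M k *v z"] by (simp add: matrix_vector_mul_assoc)
qed simp

lemma sum_norm_residual:
  "(\<Sum>i=1..k. (norm (A *v (V *v (mat_power M i *v z))))\<^sup>2) \<le> C * (norm z)\<^sup>2"
proof -
  \<comment> \<open>The residual after cycle \<open>i + 1\<close> is charged to the sweep that
    starts at iterate \<open>i\<close>, hence the index shift.\<close>
  have "(\<Sum>i=1..k. (norm (A *v (V *v (mat_power M i *v z))))\<^sup>2)
      = (\<Sum>i<k. (norm (A *v (V *v (M *v (mat_power M i *v z)))))\<^sup>2)"
    by (simp add: sum.atLeast1_atMost_eq matrix_vector_mul_assoc)
  also have "\<dots> \<le> (\<Sum>i<k. C * (norm (sweep (V *v (mat_power M i *v z))))\<^sup>2)"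
    by (intro sum_mono norm_residual_le)
  also have "\<dots> = C * ((norm z)\<^sup>2 - (norm (mat_power M k *v z))\<^sup>2)"
    by (simp add: sum_distrib_left[symmetric] sum_norm_sweep)
  also have "\<dots> \<le> C * (norm z)\<^sup>2"
    by (intro mult_left_mono C_nonneg) simp
  finally show ?thesis .
qed

text \<open>An initial error equal to the first normalized row is removed by the first step, and the
  remaining steps then change nothing; \<open>w\<close> holds the coordinates of that row.\<close>

lemma M_kernel: obtains w where "norm w = 1" "M *v w = 0"
proof -
  define i :: 'm where "i = Min UNIV"
  have i_le: "i \<le> j" for j
    by (simp add: i_def)
  define w where "w = transpose V *v row i Ah"
  have row: "transpose Ah *v axis i 1 = row i Ah"
    by (simp add: matrix_vector_mult_basis column_transpose)
  have Vw: "V *v w = row i Ah"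
    using VVt_Ah[of "axis i 1"] by (simp add: row w_def)
  have "row j Ah \<bullet> row i Ah = L $ j $ i" for j
    using i_le[of j] norm_row_Ah[of i] by (auto simp: L_nth norm_eq_1)
  \<comment> \<open>As \<open>i\<close> is the least index, column \<open>i\<close> of the
    triangular \<open>L\<close> is a full column of the Gram matrix.\<close>
  then have "Ah *v row i Ah = L *v axis i 1"
    by (simp add: vec_eq_iff matrix_vector_mul_component matrix_vector_mult_basis column_def row_def)
  then have "sweep (V *v w) = axis i 1"
    by (simp add: Vw matrix_vector_mul_assoc L_inv)
  then have "M *v w = 0"
    by (simp add: M_mult row w_def)
  moreover have "norm w = 1"
    using norm_V[of w] by (simp add: Vw norm_row_Ah)
  ultimately show thesis
    by (rule that[rotated])
qed

text \<open>Compressing \<open>M\<close> to the orthogonal complement of a kernel vector is what improves the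
  factor \<open>r\<close> to \<open>r - 1\<close>.\<close>

lemma last_iterate_residual:
  "real (Suc k) * (norm (A *v (V *v (mat_power M (Suc k) *v z))))\<^sup>2 \<le> C * (real CARD('r) - 1) * (norm z)\<^sup>2"
proof -
  obtain w where w: "norm w = 1" "M *v w = 0"
    by (rule M_kernel)
  define P where "P = proj_compl w"
  define N where "N = P ** M"
  define E where "E = matrix_inv L ** Ah ** V ** P"
  have E_mult: "E *v x = sweep (V *v (P *v x))" for x
    by (simp add: E_def matrix_vector_mul_assoc matrix_mul_assoc)
  have PP: "P ** P = P"
    using w(1) by (simp add: matrix_eq P_def matrix_vector_mul_assoc[symmetric] proj_compl_mult
        inner_diff_right norm_eq_1)
  have MP: "M ** P = M"
    by (simp add: matrix_eq P_def matrix_vector_mul_assoc[symmetric] proj_compl_mult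
        matrix_vector_mult_diff_distrib matrix_vector_mult_scaleR w(2))
  have PN: "P ** N = N" and NP: "N ** P = N"
    by (simp_all add: N_def matrix_mul_assoc PP) (simp add: matrix_mul_assoc[symmetric] MP)
  have P_le: "norm (P *v x) \<le> norm x" for x
    by (rule power2_le_imp_le) (simp_all add: P_def norm_proj_compl_mult[OF w(1)])
  have "(norm (E *v x))\<^sup>2 \<le> (norm (P *v x))\<^sup>2 - (norm (N *v x))\<^sup>2" for x
  proof -
    have "(norm (E *v x))\<^sup>2 = (norm (P *v x))\<^sup>2 - (norm (M *v x))\<^sup>2"
      using norm_M_mult[of "P *v x"] by (simp add: E_mult matrix_vector_mul_assoc[of M] MP)
    \<comment> \<open>Projecting after \<open>M\<close> can only shorten the vector, so the energy
      identity at \<open>P *v x\<close> survives as the inequality needed for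
      \<open>N\<close>.\<close>
    moreover have "(norm (N *v x))\<^sup>2 \<le> (norm (M *v x))\<^sup>2"
      by (simp add: N_def matrix_vector_mul_assoc[symmetric] P_le power_mono)
    ultimately show ?thesis
      by linarith
  qed
  from contraction_last_iterate[OF PP PN NP P_le this]
  have main: "real (Suc k) * (norm (E *v (mat_power N k *v (P *v z))))\<^sup>2 \<le> (real CARD('r) - 1) * (norm z)\<^sup>2"
    by (simp add: P_def norm_proj_compl[OF w(1)])
  have PT: "P ** (mat_power N k ** P) = mat_power N k ** P"
    by (cases k) (simp_all add: PP PN matrix_mul_assoc)
  \<comment> \<open>Since \<open>M = M ** P\<close>, each inner \<open>M\<close> may be replaced by
    \<open>N\<close>. The outermost factor stays \<open>M\<close>, so that
    \<open>norm_residual_le\<close> applies to the last cycle.\<close>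
  have MN: "mat_power M (Suc j) = M ** (mat_power N j ** P)" for j
  proof (induction j)
    case (Suc j)
    have "mat_power M (Suc (Suc j)) = M ** P ** (M ** (mat_power N j ** P))"
      using Suc by (simp add: MP)
    then show ?case
      by (simp add: N_def matrix_mul_assoc)
  qed (simp add: MP)
  define y where "y = mat_power N k *v (P *v z)"
  \<comment> \<open>On vectors fixed by \<open>P\<close> the compressed map \<open>E\<close> gives
    the true sweep.\<close>
  have "P *v y = y"
    unfolding y_def matrix_vector_mul_assoc using PT by (simp add: matrix_mul_assoc)
  then have Ey: "E *v y = sweep (V *v y)"
    by (simp add: E_mult)
  have "mat_power M (Suc k) *v z = M *v y"
    unfolding MN y_def by (simp only: matrix_vector_mul_assoc matrix_mul_assoc)
  then have "(norm (A *v (V *v (mat_power M (Suc k) *v z))))\<^sup>2 \<le> C * (norm (E *v y))\<^sup>2"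
    using norm_residual_le[of y] by (simp only: Ey)
  then have "real (Suc k) * (norm (A *v (V *v (mat_power M (Suc k) *v z))))\<^sup>2
      \<le> real (Suc k) * (C * (norm (E *v y))\<^sup>2)"
    by (rule mult_left_mono) simp
  also have "\<dots> = C * (real (Suc k) * (norm (E *v y))\<^sup>2)"
    by simp
  also have "\<dots> \<le> C * ((real CARD('r) - 1) * (norm z)\<^sup>2)"
    using main unfolding y_def by (intro mult_left_mono C_nonneg)
  finally show ?thesis
    by (simp only: mult.assoc)
qed

end

section \<open>Transfer from the coordinates \<open>z\<close> back to the iterates\<close>

theorem theorem1:
  fixes A :: "real ^ 'n ^ ('m::{finite,linorder})"
    and b :: "real ^ ('m::{finite,linorder})"
    and U :: "real ^ ('r::{finite,linorder}) ^ ('m::{finite,linorder})"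
    and S :: "real ^ ('r::{finite,linorder}) ^ ('r::{finite,linorder})"
    and V :: "real ^ ('r::{finite,linorder}) ^ 'n"
  assumes "\<forall>i. row i A \<noteq> 0"
    and "b \<in> range ((*v) A)"
    and "compact_svd A U S V"
  shows
    "(\<forall>k.
        (SUP x0 \<in> {x0. x0 \<noteq> nearest_solution A b x0}.
           ereal (norm (kaczmarz A b x0 k - nearest_solution A b x0)
                  / norm (x0 - nearest_solution A b x0)))
        = ereal (op_norm (mat_power (cycle_mat A V) k)) \<and>
        (SUP x0 \<in> {x0. x0 \<noteq> nearest_solution A b x0}.
           ereal (norm (A *v kaczmarz A b x0 k - b)
                  / norm (x0 - nearest_solution A b x0)))
        = ereal (op_norm (S ** mat_power (cycle_mat A V) k)) \<and>
        (\<forall>x0.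
           1 / (real k + 1) *
             (\<Sum>i=0..k. (norm (matrix_inv (lower_gram A) *v
                (normalize_rows A *v (kaczmarz A b x0 i - nearest_solution A b x0))))\<^sup>2)
           = ((norm (x0 - nearest_solution A b x0))\<^sup>2
              - (norm (kaczmarz A b x0 (k + 1) - nearest_solution A b x0))\<^sup>2) / (real k + 1))) \<and>
     (\<forall>x0. \<forall>k\<ge>1.
        (norm (A *v kaczmarz A b x0 k - b))\<^sup>2
        \<le> min ((op_norm (S ** cycle_mat A V))\<^sup>2
                 * (op_norm (mat_power (cycle_mat A V) (k - 1)))\<^sup>2
                 * (norm (x0 - nearest_solution A b x0))\<^sup>2)
               ((real (rank A) - 1) * (MAX i. (norm (row i A))\<^sup>2)
                 * (op_norm (lower_gram A - mat 1))\<^sup>2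
                 * (norm (x0 - nearest_solution A b x0))\<^sup>2 / real k) \<and>
        1 / real k * (\<Sum>i=1..k. (norm (A *v (kaczmarz A b x0 i - nearest_solution A b x0)))\<^sup>2)
        \<le> (MAX i. (norm (row i A))\<^sup>2)
            * (op_norm (lower_gram A - mat 1))\<^sup>2
            * (norm (x0 - nearest_solution A b x0))\<^sup>2 / real k)"
proof -
  interpret kaczmarz_svd A b U S V
    using assms by unfold_locales auto
  have err: "kaczmarz A b (p + V *v z) k - p = V *v (mat_power M k *v z)" if "A *v p = b" for p z k
    by (simp add: kaczmarz_eq[OF that])
  have res: "A *v kaczmarz A b (p + V *v z) k - b = A *v (V *v (mat_power M k *v z))"
    if "A *v p = b" for p z k
    by (simp add: kaczmarz_eq[OF that] matrix_vector_right_distrib that)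
  have sup1: "(SUP x0 \<in> {x0. x0 \<noteq> nearest_solution A b x0}.
      ereal (norm (kaczmarz A b x0 k - nearest_solution A b x0) / norm (x0 - nearest_solution A b x0)))
      = ereal (op_norm (mat_power M k))" for k
    by (rule SUP_error_ratio) (simp add: nearest_solution_eq err norm_V)
  have sup2: "(SUP x0 \<in> {x0. x0 \<noteq> nearest_solution A b x0}.
      ereal (norm (A *v kaczmarz A b x0 k - b) / norm (x0 - nearest_solution A b x0)))
      = ereal (op_norm (S ** mat_power M k))" for k
    by (rule SUP_error_ratio) (simp add: res norm_A_V matrix_vector_mul_assoc[of S])
  have avg: "1 / (real k + 1) * (\<Sum>i=0..k. (norm (sweep (kaczmarz A b x0 i - nearest_solution A b x0)))\<^sup>2)
      = ((norm (x0 - nearest_solution A b x0))\<^sup>2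
         - (norm (kaczmarz A b x0 (k + 1) - nearest_solution A b x0))\<^sup>2) / (real k + 1)" for k x0
  proof -
    obtain p z where pz: "A *v p = b" "x0 = p + V *v z" "nearest_solution A b x0 = p"
      by (rule decompose)
    have "kaczmarz A b x0 i - nearest_solution A b x0 = V *v (mat_power M i *v z)" for i
      using err[OF pz(1)] pz by simp
    moreover have "x0 - nearest_solution A b x0 = V *v z"
      using pz by simp
    moreover have "{0..k} = {..<k + 1}"
      by auto
    ultimately show ?thesis
      by (simp only: norm_V sum_norm_sweep) simp
  qed
  have bounds: "(norm (A *v kaczmarz A b x0 k - b))\<^sup>2
      \<le> min ((op_norm (S ** M))\<^sup>2 * (op_norm (mat_power M (k - 1)))\<^sup>2
               * (norm (x0 - nearest_solution A b x0))\<^sup>2)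
             ((real (rank A) - 1) * (MAX i. (norm (row i A))\<^sup>2) * (op_norm (L - mat 1))\<^sup>2
               * (norm (x0 - nearest_solution A b x0))\<^sup>2 / real k) \<and>
      1 / real k * (\<Sum>i=1..k. (norm (A *v (kaczmarz A b x0 i - nearest_solution A b x0)))\<^sup>2)
      \<le> C * (norm (x0 - nearest_solution A b x0))\<^sup>2 / real k"
    if "k \<ge> 1" for k x0
  proof -
    obtain p z where pz: "A *v p = b" "x0 = p + V *v z" "nearest_solution A b x0 = p"
      by (rule decompose)
    have e: "kaczmarz A b x0 i - nearest_solution A b x0 = V *v (mat_power M i *v z)" for i
      using err[OF pz(1)] pz by simp
    have e0: "x0 - nearest_solution A b x0 = V *v z"
      using pz by simp
    have r: "A *v kaczmarz A b x0 k - b = A *v (V *v (mat_power M k *v z))"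
      using res[OF pz(1)] pz by simp
    \<comment> \<open>The last of the \<open>k\<close> cycles is merged with \<open>S\<close> into
      \<open>S ** M\<close>, leaving \<open>j = k - 1\<close> cycles for the other factor.\<close>
    obtain j where k: "k = Suc j"
      using \<open>k \<ge> 1\<close> by (cases k) auto
    have "norm (A *v (V *v (mat_power M k *v z))) = norm ((S ** M) *v (mat_power M j *v z))"
      unfolding norm_A_V by (simp add: k matrix_vector_mul_assoc matrix_mul_assoc)
    also have "\<dots> \<le> op_norm (S ** M) * norm (mat_power M j *v z)"
      by (rule norm_le_op_norm)
    also have "\<dots> \<le> op_norm (S ** M) * (op_norm (mat_power M j) * norm z)"
      by (intro mult_left_mono norm_le_op_norm op_norm_nonneg)
    finally have "(norm (A *v (V *v (mat_power M k *v z))))\<^sup>2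
        \<le> (op_norm (S ** M) * (op_norm (mat_power M j) * norm z))\<^sup>2"
      by (rule power_mono) simp
    then have 1: "(norm (A *v (V *v (mat_power M k *v z))))\<^sup>2
        \<le> (op_norm (S ** M))\<^sup>2 * (op_norm (mat_power M (k - 1)))\<^sup>2 * (norm z)\<^sup>2"
      by (simp add: power_mult_distrib k mult.assoc)
    have 2: "(norm (A *v (V *v (mat_power M k *v z))))\<^sup>2
        \<le> (real (rank A) - 1) * (MAX i. (norm (row i A))\<^sup>2) * (op_norm (L - mat 1))\<^sup>2
           * (norm z)\<^sup>2 / real k"
      using last_iterate_residual[of j z] unfolding k card_r
      by (simp add: pos_le_divide_eq mult_ac)
    have "1 / real k * (\<Sum>i=1..k. (norm (A *v (V *v (mat_power M i *v z))))\<^sup>2)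
        \<le> 1 / real k * (C * (norm z)\<^sup>2)"
      by (intro mult_left_mono sum_norm_residual) simp
    then have 3: "1 / real k * (\<Sum>i=1..k. (norm (A *v (V *v (mat_power M i *v z))))\<^sup>2)
        \<le> C * (norm z)\<^sup>2 / real k"
      by simp
    show ?thesis
      unfolding r e e0 norm_V using 1 2 3 by (intro conjI min.boundedI)
  qed
  show ?thesis
    using sup1 sup2 avg bounds by blast
qed

end
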